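(* If $n$ is a positive integer, then $\mathbb{SL}^n$ is a compact subset of $\mathbb{C}^n$.
   Context: A real $n\times n$ matrix $A$ is stochastic if all its entries are nonnegative and every row sums to $1$. For $x\in\mathbb{C}^n$, $\Lambda(x)$ denotes the list (multiset) $\{x_1,\dots,x_n\}$, and $\operatorname{spec}(A)$ denotes the multiset of eigenvalues of $A$ (with algebraic multiplicity). Define $$\mathbb{SL}^n := \{x\in\mathbb{C}^n \mid \Lambda(x)=\operatorname{spec}(A) \text{ for some stochastic } A\in \mathsf{M}_n(\mathbb{R})\}.$$ *)

theory Defs
  imports "HOL-Analysis.Analysis" "HOL-Computational_Algebra.Computational_Algebra"
begin

definition stochastic :: "real ^ 'n ^ 'n \<Rightarrow> bool" where
  "stochastic A \<longleftrightarrow> (\<forall>i j. 0 \<le> A $ i $ j) \<and> (\<forall>i. (\<Sum>j\<in>UNIV. A $ i $ j) = 1)"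

(* det (X I - A), a determinant over the polynomial ring; [:0, 1:] is X *)
definition charpoly :: "'a :: comm_ring_1 ^ 'n ^ 'n \<Rightarrow> 'a poly" where
  "charpoly A = det (mat [:0, 1:] - (\<chi> i j. [:A $ i $ j:]))"

(* proots counts each root with its order, which is the algebraic multiplicity here *)
definition spec :: "real ^ 'n ^ 'n \<Rightarrow> complex multiset" where
  "spec A = proots (charpoly (\<chi> i j. complex_of_real (A $ i $ j)))"

definition Lam :: "complex ^ 'n \<Rightarrow> complex multiset" where
  "Lam x = {#x $ i. i \<in># mset_set UNIV#}"

definition SL :: "(complex ^ 'n) set" where
  "SL = {x. \<exists>A :: real ^ 'n ^ 'n. stochastic A \<and> Lam x = spec A}"

end

theory Submission
  imports Defs
begin

text \<open>
  The relation \<open>\<Lambda>(x) = spec A\<close> says that the characteristic polynomial of \<open>A\<close> is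
  \<open>\<Prod>\<^sub>i (X - x\<^sub>i)\<close>: one direction reads off the roots of the product, the other splits the
  characteristic polynomial, which is monic, over the complex numbers. Comparing values at
  every point \<open>t\<close>, this becomes the family of equations \<open>det (t I - A) = \<Prod>\<^sub>i (t - x\<^sub>i)\<close>
  (\<open>Lam_eq_spec_iff\<close>), which are continuous in the pair \<open>(x, A)\<close>. Hence the pairs with \<open>A\<close>
  stochastic that solve them form a closed set. That set is also bounded, because the
  entries of a stochastic matrix lie in \<open>[0, 1]\<close> and its eigenvalues lie in the closed unit
  disc. The set in question is the image of this compact set of pairs under the
  continuous projection \<open>(x, A) \<mapsto> x\<close>, so it is compact. Keeping the matrix as a second
  coordinate is what lets a limit of spectra inherit a stochastic matrix that realizes it.
\<close>

section \<open>The characteristic polynomial\<close>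

text \<open>Evaluation at \<open>t\<close> is a ring homomorphism, so it commutes with the Leibniz expansion.\<close>

lemma poly_charpoly:
  fixes A :: "'a::comm_ring_1 ^ 'n ^ 'n"
  shows "poly (charpoly A) t = det (mat t - A)"
  unfolding charpoly_def det_def poly_sum poly_mult poly_prod
  by (intro sum.cong prod.cong refl arg_cong2[where f = "(*)"])
     (auto simp: mat_def of_int_poly)

text \<open>
  Multiplying by \<open>a + b X\<close> raises the degree by at most one, and the new top coefficient is
  \<open>b\<close> times the old one. The factors are only bounded in degree because a Leibniz term of
  \<open>det (X I - A)\<close> mixes linear diagonal entries with constant off-diagonal ones.
\<close>

lemma
  fixes f :: "'i \<Rightarrow> 'a::comm_ring_1 poly"
  assumes "finite S" and "\<And>i. i \<in> S \<Longrightarrow> degree (f i) \<le> 1"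
  shows degree_prod_linear_le: "degree (prod f S) \<le> card S"
    and coeff_card_prod_linear: "coeff (prod f S) (card S) = (\<Prod>i\<in>S. coeff (f i) 1)"
proof -
  have "degree (prod f S) \<le> card S \<and> coeff (prod f S) (card S) = (\<Prod>i\<in>S. coeff (f i) 1)"
    using assms
  proof (induction S rule: finite_induct)
    case empty
    show ?case by simp
  next
    case (insert i S)
    then have IH: "degree (prod f S) \<le> card S"
        "coeff (prod f S) (card S) = (\<Prod>i\<in>S. coeff (f i) 1)"
      and deg: "degree (f i) \<le> 1"
      by auto
    have "degree (f i * prod f S) \<le> Suc (card S)"
      using degree_mult_le[of "f i" "prod f S"] IH(1) deg by linarith
    moreover have "f i = [:coeff (f i) 0, coeff (f i) 1:]"
      using deg by (auto simp: poly_eq_iff coeff_pCons coeff_eq_0 split: nat.splits)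
    then have "coeff (f i * prod f S) (Suc (card S)) = coeff (f i) 1 * coeff (prod f S) (card S)"
      using coeff_eq_0[of "prod f S" "Suc (card S)"] IH(1)
      by (metis (no_types, lifting) add.right_neutral add_0 coeff_add coeff_pCons_Suc coeff_smult
          le_imp_less_Suc mult_pCons_left mult_zero_left mult_zero_right smult_0_left pCons_0_0)
    ultimately show ?case
      using insert.hyps IH(2) by simp
  qed
  then show "degree (prod f S) \<le> card S"
    and "coeff (prod f S) (card S) = (\<Prod>i\<in>S. coeff (f i) 1)" by auto
qed

text \<open>
  In each Leibniz term the linear coefficients are entries of the identity matrix, so the
  coefficients of degree \<open>n\<close> add up to the determinant of the identity.
\<close>

lemma lead_coeff_charpoly:
  fixes A :: "'a::comm_ring_1 ^ 'n ^ 'n"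
  shows "lead_coeff (charpoly A) = 1"
proof -
  define M where "M = mat [:0, 1:] - (\<chi> i j. [:A $ i $ j:])"
  have M: "degree (M $ i $ j) \<le> 1" "coeff (M $ i $ j) 1 = mat 1 $ i $ j" for i j
    by (auto simp: M_def mat_def)
  have deg: "degree (charpoly A) \<le> CARD('n)"
    unfolding charpoly_def M_def[symmetric] det_def
  proof (rule degree_sum_le)
    fix p
    show "degree (of_int (sign p) * (\<Prod>i\<in>UNIV. M $ i $ p i)) \<le> CARD('n)"
      using degree_mult_le[of "of_int (sign p)" "\<Prod>i\<in>UNIV. M $ i $ p i"]
        degree_prod_linear_le[of UNIV "\<lambda>i. M $ i $ p i"] M(1)
      by (simp add: of_int_poly)
  qed (simp add: finite_permutations)
  have "coeff (charpoly A) (CARD('n)) = det (mat 1 :: 'a ^ 'n ^ 'n)"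
    unfolding charpoly_def M_def[symmetric] det_def coeff_sum
    using coeff_card_prod_linear[of UNIV "\<lambda>i. M $ i $ p i" for p] M
    by (intro sum.cong refl) (simp add: of_int_poly)
  then have one: "coeff (charpoly A) (CARD('n)) = 1"
    by simp
  then have "degree (charpoly A) = CARD('n)"
    using deg le_degree[of "charpoly A" "CARD('n)"] by simp
  with one show ?thesis by simp
qed

section \<open>Prescribed spectra as polynomial equations\<close>

text \<open>
  A multiset of roots has no evident continuous dependence on \<open>A\<close>; the values of the
  characteristic polynomial do, so this form is the one that passes to limits.
\<close>

lemma Lam_eq_spec_iff:
  fixes x :: "complex ^ 'n" and A :: "real ^ 'n ^ 'n"
  shows "Lam x = spec A \<longleftrightarrow>
    (\<forall>t. det (mat t - (\<chi> i j. complex_of_real (A $ i $ j))) = (\<Prod>i\<in>UNIV. t - x $ i))"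
proof -
  define p where "p = charpoly (\<chi> i j. complex_of_real (A $ i $ j))"
  define q where "q = (\<Prod>i\<in>UNIV. [:- (x $ i), 1:])"
  have q_Lam: "q = (\<Prod>z\<in>#Lam x. [:- z, 1:])"
    by (simp add: q_def Lam_def prod_unfold_prod_mset image_mset.compositionality comp_def)
  have "proots q = (\<Sum>i\<in>UNIV. {#x $ i#})"
    unfolding q_def by (subst proots_prod) auto
  also have "\<dots> = Lam x"
    by (simp add: Lam_def sum_unfold_sum_mset)
  finally have proots_q: "proots q = Lam x" .
  have "smult (lead_coeff p) (\<Prod>z\<in>#proots p. [:- z, 1:]) = p"
    by (rule complex_poly_decompose_multiset)
  moreover have "lead_coeff p = 1"
    unfolding p_def by (rule lead_coeff_charpoly)
  ultimately have p: "(\<Prod>z\<in>#proots p. [:- z, 1:]) = p"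
    by simp
  have "Lam x = spec A \<longleftrightarrow> Lam x = proots p"
    by (simp add: spec_def p_def)
  also have "\<dots> \<longleftrightarrow> p = q"
    using p q_Lam proots_q by metis
  also have "\<dots> \<longleftrightarrow> (\<forall>t. poly p t = poly q t)"
    by (metis poly_eq_poly_eq_iff ext)
  finally show ?thesis
    by (simp add: p_def q_def poly_charpoly poly_prod)
qed

section \<open>Bounds for stochastic matrices\<close>

lemma stochastic_entry_le_1:
  fixes A :: "real ^ 'n ^ 'n"
  assumes "stochastic A"
  shows "A $ i $ j \<le> 1"
proof -
  have "A $ i $ j \<le> (\<Sum>j\<in>UNIV. A $ i $ j)"
    using assms by (intro member_le_sum) (auto simp: stochastic_def)
  then show ?thesis
    using assms by (simp add: stochastic_def)
qed

text \<open>
  At a coordinate \<open>k\<close> where an eigenvector \<open>v\<close> has largest modulus, \<open>t v\<^sub>k = (A v)\<^sub>k\<close> is a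
  convex combination of coordinates of modulus at most \<open>|v\<^sub>k|\<close>.
\<close>

lemma stochastic_eigenvalue_bound:
  fixes A :: "real ^ 'n ^ 'n"
  assumes A: "stochastic A"
    and det0: "det (mat t - (\<chi> i j. complex_of_real (A $ i $ j))) = 0"
  shows "norm t \<le> 1"
proof -
  define C where "C = (\<chi> i j. complex_of_real (A $ i $ j))"
  obtain v where v: "(mat t - C) *v v = 0" "v \<noteq> 0"
    using det0 invertible_det_nz[of "mat t - C"] invertible_left_inverse[of "mat t - C"]
      matrix_left_invertible_ker[of "mat t - C"]
    unfolding C_def by blast
  have eig: "t * v $ i = (\<Sum>j\<in>UNIV. of_real (A $ i $ j) * v $ j)" for i
  proof -
    have "0 = ((mat t - C) *v v) $ i"
      using v(1) by simp
    also have "\<dots> = (\<Sum>j\<in>UNIV. (if i = j then t * v $ j else 0) - of_real (A $ i $ j) * v $ j)"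
      unfolding matrix_vector_mult_def mat_def C_def
      by (simp, intro sum.cong) (auto simp: algebra_simps)
    also have "\<dots> = t * v $ i - (\<Sum>j\<in>UNIV. of_real (A $ i $ j) * v $ j)"
      by (simp add: sum_subtractf)
    finally show ?thesis by simp
  qed
  have "\<exists>k. \<forall>i. norm (v $ i) \<le> norm (v $ k)"
  proof -
    have "Max (range (\<lambda>i. norm (v $ i))) \<in> range (\<lambda>i. norm (v $ i))"
      by (intro Max_in) auto
    then obtain k where "norm (v $ k) = Max (range (\<lambda>i. norm (v $ i)))"
      by (metis (no_types, lifting) imageE)
    then show ?thesis by (metis Max_ge finite finite_imageI rangeI)
  qed
  then obtain k where k: "\<And>i. norm (v $ i) \<le> norm (v $ k)"
    by blast
  have "v $ k \<noteq> 0"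
    using v(2) k by (metis norm_le_zero_iff norm_zero vec_eq_iff zero_index)
  have "norm t * norm (v $ k) = norm (\<Sum>j\<in>UNIV. of_real (A $ k $ j) * v $ j)"
    by (simp add: eig[symmetric] norm_mult)
  also have "\<dots> \<le> (\<Sum>j\<in>UNIV. A $ k $ j * norm (v $ k))"
    using A k by (intro sum_norm_le) (auto simp: norm_mult stochastic_def intro!: mult_left_mono)
  also have "\<dots> = 1 * norm (v $ k)"
    using A by (simp add: stochastic_def flip: sum_distrib_right)
  finally show ?thesis
    using \<open>v $ k \<noteq> 0\<close> by (simp add: mult_le_cancel_right)
qed

lemma Lam_eq_spec_norm_le_1:
  fixes x :: "complex ^ 'n" and A :: "real ^ 'n ^ 'n"
  assumes "stochastic A" and "Lam x = spec A"
  shows "norm (x $ i) \<le> 1"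
proof (rule stochastic_eigenvalue_bound[OF assms(1)])
  show "det (mat (x $ i) - (\<chi> i j. complex_of_real (A $ i $ j))) = 0"
    using assms(2) by (auto simp: Lam_eq_spec_iff)
qed

section \<open>Compactness\<close>

lemma closed_stochastic: "closed {A :: real ^ 'n ^ 'n. stochastic A}"
  unfolding stochastic_def
  by (intro closed_Collect_conj closed_Collect_all closed_Collect_le closed_Collect_eq
      continuous_intros)

lemma closed_spectral_pairs:
  "closed {(x :: complex ^ 'n, A :: real ^ 'n ^ 'n). stochastic A \<and> Lam x = spec A}"
proof -
  have "closed (snd -` {A :: real ^ 'n ^ 'n. stochastic A} :: ((complex ^ 'n) \<times> (real ^ 'n ^ 'n)) set)"
    by (intro closed_vimage_snd closed_stochastic)
  moreover have "closed {(x :: complex ^ 'n, A :: real ^ 'n ^ 'n). Lam x = spec A}"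
    \<comment> \<open>By the Leibniz formula each equation is polynomial in the entries of \<open>x\<close> and \<open>A\<close>.\<close>
    unfolding Lam_eq_spec_iff det_def case_prod_unfold
    by (intro closed_Collect_all closed_Collect_eq)
       (auto simp: mat_def intro!: continuous_intros)
  ultimately have "closed (snd -` {A. stochastic A} \<inter>
      {(x :: complex ^ 'n, A :: real ^ 'n ^ 'n). Lam x = spec A})"
    by (rule closed_Int)
  then show ?thesis
    by (rule back_subst[where P = closed]) auto
qed

lemma bounded_vec_components:
  fixes S :: "('a::real_normed_vector ^ 'n) set"
  assumes "\<And>x i. x \<in> S \<Longrightarrow> norm (x $ i) \<le> b"
  shows "bounded S"
proof (rule boundedI)
  fix x assume "x \<in> S"
  have "norm x \<le> (\<Sum>i\<in>UNIV. norm (x $ i))"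
    by (simp add: norm_vec_def L2_set_le_sum)
  also have "\<dots> \<le> (\<Sum>i\<in>(UNIV :: 'n set). b)"
    using assms \<open>x \<in> S\<close> by (intro sum_mono) auto
  finally show "norm x \<le> (\<Sum>i\<in>(UNIV :: 'n set). b)" .
qed

lemma bounded_spectral_pairs:
  "bounded {(x :: complex ^ 'n, A :: real ^ 'n ^ 'n). stochastic A \<and> Lam x = spec A}"
proof (rule bounded_subset)
  have "bounded {x :: complex ^ 'n. \<forall>i. norm (x $ i) \<le> 1}"
    by (rule bounded_vec_components[where b = 1]) auto
  moreover have "bounded {A :: real ^ 'n ^ 'n. stochastic A}"
  proof (rule bounded_vec_components)
    fix A :: "real ^ 'n ^ 'n" and i
    assume "A \<in> {A. stochastic A}"
    then have "norm (A $ i $ j) \<le> 1" for j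
      using stochastic_entry_le_1[of A i j] by (simp add: stochastic_def)
    then have "(\<Sum>j\<in>UNIV. norm (A $ i $ j)) \<le> (\<Sum>j\<in>(UNIV :: 'n set). 1)"
      by (intro sum_mono)
    moreover have "norm (A $ i) \<le> (\<Sum>j\<in>UNIV. norm (A $ i $ j))"
      by (simp only: norm_vec_def) (rule L2_set_le_sum, simp)
    ultimately show "norm (A $ i) \<le> (\<Sum>j\<in>(UNIV :: 'n set). 1)"
      by linarith
  qed
  ultimately show "bounded ({x :: complex ^ 'n. \<forall>i. norm (x $ i) \<le> 1} \<times>
      {A :: real ^ 'n ^ 'n. stochastic A})"
    by (rule bounded_Times)
qed (auto intro: Lam_eq_spec_norm_le_1)

theorem theorem3p9:
  shows "compact (SL :: (complex ^ 'n) set)"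
proof -
  define K where
    "K = {(x :: complex ^ 'n, A :: real ^ 'n ^ 'n). stochastic A \<and> Lam x = spec A}"
  have "compact K"
    unfolding K_def compact_eq_bounded_closed
    using bounded_spectral_pairs closed_spectral_pairs by blast
  then have "compact (fst ` K)"
    by (intro compact_continuous_image continuous_intros)
  moreover have "fst ` K = SL"
    by (force simp: K_def SL_def)
  ultimately show ?thesis by simp
qed

end
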